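(* Let $(\mathcal T,\preceq)$ be a rooted non-metric tree. Then the Scott topology on $(\mathcal T,\preceq)$ is strictly coarser than the weak tree topology on $\mathcal T$; that is, every Scott open subset of $\mathcal T$ is open in the weak tree topology, and there exists a subset of $\mathcal T$ that is open in the weak tree topology but not Scott open.
   Context: A rooted non-metric tree is a partially ordered set $(\mathcal T,\preceq)$ such that: (T1) there exists a (unique) smallest element $t_0\in\mathcal T$; (T2) every set of the form $I_t=\{a\in\mathcal T\mid a\preceq t\}$ is isomorphic, as an ordered set, to a real interval; (T3) every totally ordered convex subset of $\mathcal T$ is isomorphic to a real interval; (T4) every non-empty subset of $\mathcal T$ admits an infimum in $\mathcal T$. A subset $C$ is convex if $x,y\in C$ and $x\preceq z\preceq y$ imply $z\in C$. For $a,b\in\mathcal T$ let $a\wedge b$ denote the infimum of $\{a,b\}$, and define the closed segment $$[a,b]:=\{c\in\mathcal T\mid (a\wedge b\preceq c\preceq a)\text{ or }(a\wedge b\preceq c\preceq b)\}.$$ For $t\in\mathcal T$ define an equivalence relation on $\mathcal T\setminus\{t\}$ by $a\sim_t b$ if and only if $t\notin[a,b]$, and for $a\in\mathcal T\setminus\{t\}$ let $[a]_t$ be the equivalence class of $a$ under $\sim_t$. The weak tree topology on $\mathcal T$ is the topology generated (as a subbasis) by all sets $[a]_t$ with $a,t\in\mathcal T$, $a\neq t$. For a partially ordered set $(\mathcal P,\preceq)$, a subset $\mathcal S$ is an upper set if $x\in\mathcal S$, $y\in\mathcal P$ and $x\preceq y$ imply $y\in\mathcal S$. It is inaccessible by directed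 joins if for every directed subset $\mathcal D\subseteq\mathcal P$, if $\sup\mathcal D\in\mathcal S$ (in particular the supremum exists), then $\mathcal D\cap\mathcal S\neq\emptyset$. The Scott topology on $\mathcal P$ is the topology whose open sets are exactly the upper sets that are inaccessible by directed joins.
   Formalization: The existence of a weakly open set that is not Scott open is claimed only for trees with at least two points; for the one-point tree both topologies consist of the empty set and the whole tree, so strictness fails there. *)

theory Defs
  imports "HOL-Analysis.Analysis" "HOL-Algebra.Lattice"
begin

section \<open>Rooted non-metric trees\<close>

text \<open>Real intervals are \<^const>\<open>is_interval\<close> subsets of the real line: they may be open,
  closed, half-open, unbounded, degenerate or empty.  Degenerate intervals cannot be excluded,
  since the initial segment below the root is a singleton, and the empty subset of a tree is
  totally ordered and convex.\<close>

definition iso_real_interval :: "('a, 'b) gorder_scheme \<Rightarrow> 'a set \<Rightarrow> bool" where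
  "iso_real_interval L C \<longleftrightarrow>
     (\<exists>(J :: real set) f. is_interval J \<and> bij_betw f C J \<and>
        (\<forall>x\<in>C. \<forall>y\<in>C. x \<sqsubseteq>\<^bsub>L\<^esub> y \<longleftrightarrow> f x \<le> f y))"

definition totally_ordered_subset :: "('a, 'b) gorder_scheme \<Rightarrow> 'a set \<Rightarrow> bool" where
  "totally_ordered_subset L C \<longleftrightarrow>
     C \<subseteq> carrier L \<and> (\<forall>x\<in>C. \<forall>y\<in>C. x \<sqsubseteq>\<^bsub>L\<^esub> y \<or> y \<sqsubseteq>\<^bsub>L\<^esub> x)"

definition order_convex :: "('a, 'b) gorder_scheme \<Rightarrow> 'a set \<Rightarrow> bool" where
  "order_convex L C \<longleftrightarrow>
     C \<subseteq> carrier L \<and>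
     (\<forall>x\<in>C. \<forall>y\<in>C. \<forall>z\<in>carrier L. x \<sqsubseteq>\<^bsub>L\<^esub> z \<and> z \<sqsubseteq>\<^bsub>L\<^esub> y \<longrightarrow> z \<in> C)"

locale rooted_nonmetric_tree = partial_order T for T (structure) +
  assumes root_exists: "\<exists>t\<^sub>0. least T t\<^sub>0 (carrier T)"
    and initial_segment_interval:
      "t \<in> carrier T \<Longrightarrow> iso_real_interval T {a \<in> carrier T. a \<sqsubseteq> t}"
    and convex_chain_interval:
      "\<lbrakk>totally_ordered_subset T C; order_convex T C\<rbrakk> \<Longrightarrow> iso_real_interval T C"
    and infimum_exists:
      "\<lbrakk>A \<subseteq> carrier T; A \<noteq> {}\<rbrakk> \<Longrightarrow> \<exists>i. greatest T i (Lower T A)"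


section \<open>The weak tree topology\<close>

definition tree_segment :: "('a, 'b) gorder_scheme \<Rightarrow> 'a \<Rightarrow> 'a \<Rightarrow> 'a set" where
  "tree_segment T a b =
     {c \<in> carrier T. (a \<sqinter>\<^bsub>T\<^esub> b \<sqsubseteq>\<^bsub>T\<^esub> c \<and> c \<sqsubseteq>\<^bsub>T\<^esub> a) \<or> (a \<sqinter>\<^bsub>T\<^esub> b \<sqsubseteq>\<^bsub>T\<^esub> c \<and> c \<sqsubseteq>\<^bsub>T\<^esub> b)}"

definition tangent_rel :: "('a, 'b) gorder_scheme \<Rightarrow> 'a \<Rightarrow> ('a \<times> 'a) set" where
  "tangent_rel T t =
     {(a, b). a \<in> carrier T - {t} \<and> b \<in> carrier T - {t} \<and> t \<notin> tree_segment T a b}"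

definition tangent_class :: "('a, 'b) gorder_scheme \<Rightarrow> 'a \<Rightarrow> 'a \<Rightarrow> 'a set" where
  "tangent_class T t a = tangent_rel T t `` {a}"

text \<open>\<^const>\<open>topology_generated_by\<close> closes under nonempty finite intersections and arbitrary unions
  only.  The whole tree, which is the empty intersection, is therefore added to the subbasis;
  this matters only for the one-point tree, whose subbasis of classes is empty.\<close>

definition weak_tree_topology :: "('a, 'b) gorder_scheme \<Rightarrow> 'a topology" where
  "weak_tree_topology T =
     topology_generated_by
       (insert (carrier T)
         {tangent_class T t a | a t. a \<in> carrier T \<and> t \<in> carrier T \<and> a \<noteq> t})"

lemma topspace_weak_tree_topology: "topspace (weak_tree_topology T) = carrier T"
  by (auto simp: weak_tree_topology_def tangent_class_def tangent_rel_def)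


section \<open>The Scott topology\<close>

text \<open>Directed sets are nonempty, as usual.\<close>

definition directed_subset :: "('a, 'b) gorder_scheme \<Rightarrow> 'a set \<Rightarrow> bool" where
  "directed_subset L D \<longleftrightarrow>
     D \<subseteq> carrier L \<and> D \<noteq> {} \<and> (\<forall>x\<in>D. \<forall>y\<in>D. \<exists>z\<in>D. x \<sqsubseteq>\<^bsub>L\<^esub> z \<and> y \<sqsubseteq>\<^bsub>L\<^esub> z)"

definition upper_set :: "('a, 'b) gorder_scheme \<Rightarrow> 'a set \<Rightarrow> bool" where
  "upper_set L S \<longleftrightarrow>
     S \<subseteq> carrier L \<and> (\<forall>x\<in>S. \<forall>y\<in>carrier L. x \<sqsubseteq>\<^bsub>L\<^esub> y \<longrightarrow> y \<in> S)"

definition inaccessible_by_directed_joins :: "('a, 'b) gorder_scheme \<Rightarrow> 'a set \<Rightarrow> bool" where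
  "inaccessible_by_directed_joins L S \<longleftrightarrow>
     (\<forall>D s. directed_subset L D \<and> least L s (Upper L D) \<and> s \<in> S \<longrightarrow> D \<inter> S \<noteq> {})"

definition scott_open :: "('a, 'b) gorder_scheme \<Rightarrow> 'a set \<Rightarrow> bool" where
  "scott_open L S \<longleftrightarrow> upper_set L S \<and> inaccessible_by_directed_joins L S"

definition scott_topology :: "('a, 'b) gorder_scheme \<Rightarrow> 'a topology" where
  "scott_topology L = topology (scott_open L)"

lemma istopology_scott_open: "istopology (scott_open L)"
  unfolding istopology_def
proof (intro conjI allI impI)
  fix S S' assume S: "scott_open L S" and S': "scott_open L S'"
  have "upper_set L (S \<inter> S')"
    using S S' by (auto simp: scott_open_def upper_set_def)
  moreover have "D \<inter> (S \<inter> S') \<noteq> {}"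
    if D: "directed_subset L D" and s: "least L s (Upper L D)" "s \<in> S \<inter> S'" for D s
  proof -
    obtain x where x: "x \<in> D" "x \<in> S"
      using S D s unfolding scott_open_def inaccessible_by_directed_joins_def by blast
    obtain y where y: "y \<in> D" "y \<in> S'"
      using S' D s unfolding scott_open_def inaccessible_by_directed_joins_def by blast
    obtain z where z: "z \<in> D" "z \<in> carrier L" "x \<sqsubseteq>\<^bsub>L\<^esub> z" "y \<sqsubseteq>\<^bsub>L\<^esub> z"
      using D x y unfolding directed_subset_def by blast
    have "z \<in> S" "z \<in> S'"
      using S S' x y z unfolding scott_open_def upper_set_def by blast+
    with z show ?thesis by blast
  qed
  ultimately show "scott_open L (S \<inter> S')"
    unfolding scott_open_def inaccessible_by_directed_joins_def by blast
next
  fix \<K> assume \<K>: "\<forall>K\<in>\<K>. scott_open L K"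
  then have "upper_set L (\<Union> \<K>)"
    unfolding scott_open_def upper_set_def by blast
  moreover have "D \<inter> \<Union> \<K> \<noteq> {}"
    if D: "directed_subset L D" and s: "least L s (Upper L D)" "s \<in> \<Union> \<K>" for D s
  proof -
    obtain K where K: "K \<in> \<K>" "s \<in> K" using s by blast
    then have "D \<inter> K \<noteq> {}"
      using \<K> D s unfolding scott_open_def inaccessible_by_directed_joins_def by blast
    with K show ?thesis by blast
  qed
  ultimately show "scott_open L (\<Union> \<K>)"
    unfolding scott_open_def inaccessible_by_directed_joins_def by blast
qed

lemma openin_scott_topology: "openin (scott_topology L) S \<longleftrightarrow> scott_open L S"
  by (simp add: scott_topology_def topology_inverse' istopology_scott_open)

lemma topspace_scott_topology: "topspace (scott_topology L) = carrier L"
proof -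
  have "scott_open L (carrier L)"
    unfolding scott_open_def upper_set_def inaccessible_by_directed_joins_def
      directed_subset_def by blast
  moreover have "S \<subseteq> carrier L" if "scott_open L S" for S
    using that by (auto simp: scott_open_def upper_set_def)
  ultimately show ?thesis
    unfolding topspace_def openin_scott_topology by blast
qed


section \<open>The tangent relation is an equivalence\<close>

context rooted_nonmetric_tree
begin

lemma meet_facts:
  assumes "a \<in> carrier T" "b \<in> carrier T"
  shows "a \<sqinter> b \<in> carrier T" "a \<sqinter> b \<sqsubseteq> a" "a \<sqinter> b \<sqsubseteq> b"
    and "\<And>c. \<lbrakk>c \<in> carrier T; c \<sqsubseteq> a; c \<sqsubseteq> b\<rbrakk> \<Longrightarrow> c \<sqsubseteq> a \<sqinter> b"
proof -
  have "\<exists>i. greatest T i (Lower T {a, b})"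
    using infimum_exists[of "{a, b}"] assms by simp
  then have "greatest T (a \<sqinter> b) (Lower T {a, b})"
    unfolding meet_def inf_def by (rule someI_ex)
  then show "a \<sqinter> b \<in> carrier T" "a \<sqinter> b \<sqsubseteq> a" "a \<sqinter> b \<sqsubseteq> b"
    "\<And>c. \<lbrakk>c \<in> carrier T; c \<sqsubseteq> a; c \<sqsubseteq> b\<rbrakk> \<Longrightarrow> c \<sqsubseteq> a \<sqinter> b"
    using assms by (auto simp: greatest_def Lower_def)
qed

lemma meet_comm: "a \<sqinter> b = b \<sqinter> a"
  by (simp add: meet_def insert_commute)

lemma below_comparable:
  assumes "t \<in> carrier T" "a \<in> carrier T" "b \<in> carrier T" "a \<sqsubseteq> t" "b \<sqsubseteq> t"
  shows "a \<sqsubseteq> b \<or> b \<sqsubseteq> a"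
  using initial_segment_interval[OF assms(1)] assms
  unfolding iso_real_interval_def by (metis (mono_tags, lifting) linear mem_Collect_eq)

lemma tree_segment_comm: "tree_segment T a b = tree_segment T b a"
  by (auto simp: tree_segment_def meet_comm)

lemma tree_segment_half:
  assumes abc: "a \<in> carrier T" "b \<in> carrier T" "c \<in> carrier T"
    and t: "t \<in> carrier T" "a \<sqinter> c \<sqsubseteq> t" "t \<sqsubseteq> a"
  shows "t \<in> tree_segment T a b \<union> tree_segment T b c"
proof (cases "a \<sqinter> b \<sqsubseteq> t")
  case True
  then show ?thesis using t by (auto simp: tree_segment_def)
next
  case False
  note ab = meet_facts[OF abc(1,2)] and bc = meet_facts[OF abc(2,3)]
    and ac = meet_facts[OF abc(1,3)]
  have "t \<sqsubseteq> a \<sqinter> b"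
    using below_comparable[of a "a \<sqinter> b" t] False abc ab t by blast
  then have tb: "t \<sqsubseteq> b" by (meson ab abc t le_trans)
  have "\<not> a \<sqinter> b \<sqsubseteq> b \<sqinter> c"
  proof
    assume "a \<sqinter> b \<sqsubseteq> b \<sqinter> c"
    then have "a \<sqinter> b \<sqsubseteq> c" by (meson ab bc abc le_trans)
    then have "a \<sqinter> b \<sqsubseteq> a \<sqinter> c" using ab ac by blast
    then show False by (meson False t ab ac le_trans)
  qed
  then have "b \<sqinter> c \<sqsubseteq> a \<sqinter> b"
    using below_comparable[of b "a \<sqinter> b" "b \<sqinter> c"] abc ab bc by blast
  then have "b \<sqinter> c \<sqsubseteq> a" by (meson ab bc abc le_trans)
  then have "b \<sqinter> c \<sqsubseteq> a \<sqinter> c" using ac bc by blast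
  then have "b \<sqinter> c \<sqsubseteq> t" by (meson t ac bc le_trans)
  with tb t show ?thesis by (auto simp: tree_segment_def)
qed

lemma tree_segment_subset:
  assumes "a \<in> carrier T" "b \<in> carrier T" "c \<in> carrier T"
  shows "tree_segment T a c \<subseteq> tree_segment T a b \<union> tree_segment T b c"
proof
  fix t assume "t \<in> tree_segment T a c"
  then consider "t \<in> carrier T" "a \<sqinter> c \<sqsubseteq> t" "t \<sqsubseteq> a" | "t \<in> carrier T" "c \<sqinter> a \<sqsubseteq> t" "t \<sqsubseteq> c"
    by (auto simp: tree_segment_def meet_comm)
  then show "t \<in> tree_segment T a b \<union> tree_segment T b c"
    using tree_segment_half[of a b c t] tree_segment_half[of c b a t] assms
    by cases (auto simp: tree_segment_comm)
qed

lemma equiv_tangent_rel: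
  assumes "t \<in> carrier T"
  shows "equiv (carrier T - {t}) (tangent_rel T t)"
proof (rule equivI)
  show "tangent_rel T t \<subseteq> (carrier T - {t}) \<times> (carrier T - {t})"
    by (auto simp: tangent_rel_def)
  have "t \<notin> tree_segment T a a" if "a \<in> carrier T" "a \<noteq> t" for a
  proof
    assume "t \<in> tree_segment T a a"
    then have "a \<sqinter> a \<sqsubseteq> t" "t \<sqsubseteq> a" by (auto simp: tree_segment_def)
    moreover have "a \<sqsubseteq> a \<sqinter> a" using meet_facts[of a a] that by blast
    ultimately have "a \<sqsubseteq> t" by (meson that assms meet_facts(1) le_trans)
    with \<open>t \<sqsubseteq> a\<close> that assms show False by blast
  qed
  then show "refl_on (carrier T - {t}) (tangent_rel T t)"
    by (auto simp: refl_on_def tangent_rel_def)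
  show "sym (tangent_rel T t)"
    by (auto simp: sym_def tangent_rel_def tree_segment_comm)
  show "trans (tangent_rel T t)"
  proof (rule transI)
    fix a b c assume "(a, b) \<in> tangent_rel T t" "(b, c) \<in> tangent_rel T t"
    then show "(a, c) \<in> tangent_rel T t"
      using tree_segment_subset[of a b c] unfolding tangent_rel_def by blast
  qed
qed

end

end

theory Submission
  imports Defs
begin

text \<open>Let \<open>x\<close> be a point of a Scott open set \<open>U\<close> other than the root. Initial segments are densely
  ordered, so \<open>x\<close> is the supremum of the chain of points strictly below it, and hence \<open>U\<close> contains
  some \<open>t\<close> strictly below \<open>x\<close>. The tangent class of \<open>x\<close> at \<open>t\<close> lies above \<open>t\<close>, so it is a weak
  neighbourhood of \<open>x\<close> inside \<open>U\<close>. Conversely, the tangent class of the root at any other point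
  is weakly open but not an upper set.\<close>

context rooted_nonmetric_tree
begin

text \<open>The order isomorphism onto a real interval reduces this to density of the reals: a
  number between the images of \<open>y\<close> and \<open>x\<close> stays in the interval and pulls
  back to the tree.\<close>

lemma ex_strictly_between:
  assumes x: "x \<in> carrier T" and y: "y \<in> carrier T" "y \<sqsubseteq> x" "y \<noteq> x"
  shows "\<exists>z\<in>carrier T. y \<sqsubseteq> z \<and> z \<sqsubseteq> x \<and> z \<noteq> y \<and> z \<noteq> x"
proof -
  let ?I = "{a \<in> carrier T. a \<sqsubseteq> x}"
  obtain J :: "real set" and f where J: "is_interval J" and f: "bij_betw f ?I J"
    and mono: "\<And>a b. \<lbrakk>a \<in> ?I; b \<in> ?I\<rbrakk> \<Longrightarrow> a \<sqsubseteq> b \<longleftrightarrow> f a \<le> f b"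
    using initial_segment_interval[OF x] unfolding iso_real_interval_def by blast
  have xy: "x \<in> ?I" "y \<in> ?I" using x y by auto
  have "f y \<le> f x" using mono[OF xy(2,1)] y by blast
  moreover have "f y \<noteq> f x"
    using f xy y(3) by (auto simp: bij_betw_def inj_on_def)
  ultimately have lt: "f y < f x" by simp
  then obtain w where w: "f y < w" "w < f x" using dense by blast
  have "f x \<in> J" "f y \<in> J" using f xy by (auto simp: bij_betw_def)
  then have "w \<in> J" using J w unfolding is_interval_1 by (meson less_imp_le)
  then obtain z where z: "z \<in> ?I" "f z = w" using f by (auto simp: bij_betw_def)
  have "y \<sqsubseteq> z" using mono[OF xy(2) z(1)] z(2) w by simp
  moreover have "z \<noteq> y" "z \<noteq> x" using z(2) w by auto
  ultimately show ?thesis using z(1) by blast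
qed

text \<open>If an upper bound \<open>y\<close> were not above \<open>x\<close>, then
  \<open>x \<sqinter> y\<close> would lie strictly below \<open>x\<close>. A point \<open>z\<close>
  strictly between the two is bounded by both \<open>x\<close> and \<open>y\<close>, hence by their
  meet, which is absurd. At the root the set is empty, and the root is indeed its least upper
  bound.\<close>

lemma least_Upper_strictly_below:
  assumes x: "x \<in> carrier T"
  shows "least T x (Upper T {a \<in> carrier T. a \<sqsubseteq> x \<and> a \<noteq> x})"
proof -
  let ?D = "{a \<in> carrier T. a \<sqsubseteq> x \<and> a \<noteq> x}"
  have "x \<sqsubseteq> y" if y: "y \<in> carrier T" and ub: "\<And>d. d \<in> ?D \<Longrightarrow> d \<sqsubseteq> y" for y
  proof (rule ccontr)
    assume nle: "\<not> x \<sqsubseteq> y"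
    note m = meet_facts[OF x y]
    have "x \<sqinter> y \<noteq> x" using m(3) nle by auto
    then obtain z where z: "z \<in> carrier T" "x \<sqinter> y \<sqsubseteq> z" "z \<sqsubseteq> x" "z \<noteq> x \<sqinter> y" "z \<noteq> x"
      using ex_strictly_between[OF x m(1,2)] by metis
    then have "z \<sqsubseteq> x \<sqinter> y" by (intro m(4) ub) auto
    then show False using z m(1) by (metis le_antisym)
  qed
  then show ?thesis using x by (simp add: least_def Upper_def)
qed

lemma scott_open_contains_strictly_below:
  assumes U: "scott_open T U" and x: "x \<in> U" and y: "y \<in> carrier T" "y \<sqsubseteq> x" "y \<noteq> x"
  shows "\<exists>t\<in>U. t \<sqsubseteq> x \<and> t \<noteq> x"
proof -
  let ?D = "{a \<in> carrier T. a \<sqsubseteq> x \<and> a \<noteq> x}"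
  have xT: "x \<in> carrier T" using U x by (auto simp: scott_open_def upper_set_def)
  have "directed_subset T ?D"
    unfolding directed_subset_def
  proof (intro conjI ballI)
    fix a b assume ab: "a \<in> ?D" "b \<in> ?D"
    then have "a \<sqsubseteq> b \<or> b \<sqsubseteq> a" using below_comparable[OF xT] by blast
    moreover have "a \<sqsubseteq> a" "b \<sqsubseteq> b" using ab by auto
    ultimately show "\<exists>z\<in>?D. a \<sqsubseteq> z \<and> b \<sqsubseteq> z" using ab by blast
  \<comment> \<open>The point \<open>y\<close> witnesses that \<open>?D\<close> is nonempty, as
    directedness demands; this fails at the root.\<close>
  qed (use y in auto)
  then have "?D \<inter> U \<noteq> {}"
    using U x least_Upper_strictly_below[OF xT]
    unfolding scott_open_def inaccessible_by_directed_joins_def by blast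
  then show ?thesis by blast
qed

lemma openin_tangent_class:
  assumes "a \<in> carrier T" "t \<in> carrier T" "a \<noteq> t"
  shows "openin (weak_tree_topology T) (tangent_class T t a)"
  unfolding weak_tree_topology_def
  by (rule topology_generated_by_Basis) (use assms in blast)

lemma self_in_tangent_class:
  assumes "a \<in> carrier T" "t \<in> carrier T" "a \<noteq> t"
  shows "a \<in> tangent_class T t a"
  using equiv_class_self[OF equiv_tangent_rel[OF assms(2)]] assms
  by (auto simp: tangent_class_def)

text \<open>Both \<open>t\<close> and \<open>x \<sqinter> a\<close> lie below \<open>x\<close>, so
  they are comparable. Since \<open>t\<close> is off the segment from \<open>x\<close> to
  \<open>a\<close>, it must lie below the meet, hence below \<open>a\<close>.\<close>

lemma tangent_class_above:
  assumes x: "x \<in> carrier T" and t: "t \<in> carrier T" "t \<sqsubseteq> x"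
    and a: "a \<in> tangent_class T t x"
  shows "t \<sqsubseteq> a"
proof -
  have aT: "a \<in> carrier T" and seg: "t \<notin> tree_segment T x a"
    using a by (auto simp: tangent_class_def tangent_rel_def)
  note m = meet_facts[OF x aT]
  have "\<not> x \<sqinter> a \<sqsubseteq> t" using seg t by (auto simp: tree_segment_def)
  then have "t \<sqsubseteq> x \<sqinter> a" using below_comparable[OF x t(1) m(1) t(2) m(2)] by blast
  then show ?thesis using le_trans[OF _ m(3) t(1) m(1) aT] by blast
qed

lemma scott_open_imp_weak_open:
  assumes U: "scott_open T U"
  shows "openin (weak_tree_topology T) U"
proof (subst openin_subopen, intro ballI)
  fix x assume x: "x \<in> U"
  have sub: "U \<subseteq> carrier T" and up: "\<And>a b. \<lbrakk>a \<in> U; b \<in> carrier T; a \<sqsubseteq> b\<rbrakk> \<Longrightarrow> b \<in> U"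
    using U by (auto simp: scott_open_def upper_set_def)
  obtain r where r: "r \<in> carrier T" "\<And>a. a \<in> carrier T \<Longrightarrow> r \<sqsubseteq> a"
    using root_exists unfolding least_def by blast
  show "\<exists>V. openin (weak_tree_topology T) V \<and> x \<in> V \<and> V \<subseteq> U"
  proof (cases "r = x")
    case True
    \<comment> \<open>The root has no point strictly below it to serve as \<open>t\<close>, but an
      upper set containing the root is the whole tree.\<close>
    then have "U = carrier T" using x sub up r by blast
    then show ?thesis using x openin_topspace[of "weak_tree_topology T"]
      by (auto simp: topspace_weak_tree_topology)
  next
    case False
    then obtain t where t: "t \<in> U" "t \<sqsubseteq> x" "t \<noteq> x"
      using scott_open_contains_strictly_below[OF U x r(1)] r(2) sub x by (metis subsetD)
    have xT: "x \<in> carrier T" and tT: "t \<in> carrier T" using x t sub by auto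
    have "tangent_class T t x \<subseteq> carrier T"
      by (auto simp: tangent_class_def tangent_rel_def)
    then have "tangent_class T t x \<subseteq> U"
      using tangent_class_above[OF xT tT t(2)] up[OF t(1)] by blast
    then show ?thesis
      using openin_tangent_class[OF xT tT] self_in_tangent_class[OF xT tT] t(3) by blast
  qed
qed

lemma ex_weak_open_not_scott_open:
  assumes "a \<in> carrier T" "b \<in> carrier T" "a \<noteq> b"
  shows "\<exists>U. openin (weak_tree_topology T) U \<and> \<not> scott_open T U"
proof -
  obtain r where r: "r \<in> carrier T" "\<And>a. a \<in> carrier T \<Longrightarrow> r \<sqsubseteq> a"
    using root_exists unfolding least_def by blast
  \<comment> \<open>At least one of the distinct points \<open>a\<close> and \<open>b\<close> is not
    the root.\<close>
  obtain c where c: "c \<in> carrier T" "r \<noteq> c" using assms by metis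
  have "c \<notin> tangent_class T c r" by (auto simp: tangent_class_def tangent_rel_def)
  then have "\<not> scott_open T (tangent_class T c r)"
    using self_in_tangent_class[OF r(1) c] r(2)[OF c(1)] c(1)
    unfolding scott_open_def upper_set_def by blast
  then show ?thesis using openin_tangent_class[OF r(1) c] by blast
qed

end

text \<open>Strictness is asserted for trees with two distinct points: on a one-point tree both
  topologies consist of the empty set and the whole tree.\<close>

theorem theorem1p1:
  fixes T :: "('a, 'b) gorder_scheme"
  assumes "rooted_nonmetric_tree T"
  shows "(\<forall>U. openin (scott_topology T) U \<longrightarrow> openin (weak_tree_topology T) U) \<and>
    ((\<exists>a\<in>carrier T. \<exists>b\<in>carrier T. a \<noteq> b) \<longrightarrow>
      (\<exists>U. openin (weak_tree_topology T) U \<and> \<not> openin (scott_topology T) U))"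
proof -
  interpret rooted_nonmetric_tree T by (rule assms)
  show ?thesis
    using scott_open_imp_weak_open ex_weak_open_not_scott_open
    by (auto simp: openin_scott_topology)
qed

end
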